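(* If $f\in\Omega$, then $f\in G_{\frac12,\frac12}$ in the disc $|z|<r_0$, i.e. $$\left|\frac{\frac12+\frac12 zf''(z)/f'(z)}{zf'(z)/f(z)}-\frac12\right|<\frac12\qquad\text{for all }|z|<r_0,$$ where $r_0\approx0.430496$ is the smallest positive root of $$55r^{12}-28r^{11}-854r^{10}+148r^9+2969r^8-212r^7-4286r^6+28r^5+2875r^4+96r^3-888r^2-32r+96=0.$$
   Context: $\mathbb{D}=\{z\in\mathbb{C}:|z|<1\}$. $\mathcal{A}$ is the class of analytic functions $f$ on $\mathbb{D}$ with $f(0)=0$, $f'(0)=1$. $\Omega=\{f\in\mathcal{A}:|zf'(z)-f(z)|<\frac12,\ z\in\mathbb{D}\}$. For $0<\alpha\le1$ and $\lambda>0$, $$G_{\lambda,\alpha}=\left\{f\in\mathcal{A}:\left|\frac{1-\alpha+\alpha zf''(z)/f'(z)}{zf'(z)/f(z)}-(1-\alpha)\right|<\lambda,\ z\in\mathbb{D}\right\};$$ "$f\in G_{\lambda,\alpha}$ in the disc $|z|<r_0$" means that the defining inequality holds for all $|z|<r_0$. Expressions such as $zf'(z)/f(z)$ are given their limiting values at $z=0$. *)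

theory Defs
  imports "HOL-Complex_Analysis.Complex_Analysis"
begin

text \<open>
  Functions on the unit disc are total functions of type complex to complex; only their values on
  the open unit ball matter.
\<close>

definition class_A :: "(complex \<Rightarrow> complex) set" where
  "class_A = {f. f holomorphic_on ball 0 1 \<and> f 0 = 0 \<and> deriv f 0 = 1}"

definition class_Omega :: "(complex \<Rightarrow> complex) set" where
  "class_Omega = {f \<in> class_A. \<forall>z\<in>ball 0 1. cmod (z * deriv f z - f z) < 1 / 2}"

text \<open>
  The quotient \<open>z f'(z) / f(z)\<close> with its limiting value at the origin. Without the case
  distinction the totalised division would give 0 there.
\<close>

definition starlike_quotient :: "(complex \<Rightarrow> complex) \<Rightarrow> complex \<Rightarrow> complex" where
  "starlike_quotient f z =
     (if z = 0 then Lim (at 0) (\<lambda>w. w * deriv f w / f w) else z * deriv f z / f z)"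

text \<open>
  The set \<open>class_G_in r lambda alpha\<close> consists of the functions that belong to
  \<open>G\<^bsub>lambda,alpha\<^esub>\<close> in the disc \<open>|z| < r\<close>, for \<open>0 < r \<le> 1\<close>; the class \<open>G\<^bsub>lambda,alpha\<^esub>\<close> itself
  is the case \<open>r = 1\<close>. The intended parameters are \<open>0 < alpha \<le> 1\<close> and \<open>0 < lambda\<close>.
  The two nonvanishing conditions say that the quotients in the inequality are genuine, so that
  the inequality cannot hold through the convention \<open>x / 0 = 0\<close>.
\<close>

definition class_G_in :: "real \<Rightarrow> real \<Rightarrow> real \<Rightarrow> (complex \<Rightarrow> complex) set" where
  "class_G_in r lambda alpha =
     {f \<in> class_A. \<forall>z\<in>ball 0 r.
        deriv f z \<noteq> 0 \<and> (z \<noteq> 0 \<longrightarrow> f z \<noteq> 0) \<and>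
        cmod ((1 - of_real alpha + of_real alpha * (z * (deriv ^^ 2) f z / deriv f z))
                / starlike_quotient f z - (1 - of_real alpha)) < lambda}"

definition smallest_positive_root :: "(real \<Rightarrow> real) \<Rightarrow> real \<Rightarrow> bool" where
  "smallest_positive_root p r \<longleftrightarrow> 0 < r \<and> p r = 0 \<and> (\<forall>s. 0 < s \<and> p s = 0 \<longrightarrow> r \<le> s)"

end

theory Submission
  imports Defs
begin

text \<open>
  Write \<open>f z = z * g z\<close>. The condition \<open>|z f' - f| < 1/2\<close> reads \<open>|2 z\<^sup>2 g'| < 1\<close>, so two applications
  of the Schwarz lemma give \<open>|2 g'| \<le> 1\<close>, whence \<open>|g - 1| \<le> |z| / 2\<close>, and the Schwarz--Pick
  inequality for \<open>2 g'\<close> bounds \<open>g''\<close>. The quantity to be estimated equals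
  \<open>(z g g' + z\<^sup>2 g g'' - z\<^sup>2 g'\<^sup>2) / (2 (g + z g')\<^sup>2)\<close>, and already the triangle inequality bounds it by
  \<open>1/2\<close> for \<open>|z| \<le> 0.431\<close>, a disc slightly larger than the one of radius \<open>r0\<close>.
\<close>

section \<open>Schwarz--Pick inequality under a non-strict bound\<close>

text \<open>A point where \<open>cmod (f w)\<close> reaches 1 would be an interior maximum of the
  modulus. Dividing out a zero leaves only a non-strict bound; the dichotomy recovers the strict one
  that a further use of the Schwarz lemma requires.\<close>

lemma holomorphic_norm_le_1_cases:
  assumes holf: "f holomorphic_on ball 0 1" and le: "\<And>z. cmod z < 1 \<Longrightarrow> cmod (f z) \<le> 1"
  shows "(\<forall>z. cmod z < 1 \<longrightarrow> cmod (f z) < 1) \<or> f constant_on ball 0 1"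
proof (rule disjCI)
  assume "\<not> f constant_on ball 0 1"
  show "\<forall>z. cmod z < 1 \<longrightarrow> cmod (f z) < 1"
  proof (intro allI impI, rule ccontr)
    fix w assume w: "cmod w < 1" and "\<not> cmod (f w) < 1"
    then have "cmod (f z) \<le> cmod (f w)" if "z \<in> ball 0 1" for z
      using le[of z] that by auto
    then have "f constant_on ball 0 1"
      using maximum_modulus_principle[OF holf, of "ball 0 1" w] w by auto
    with \<open>\<not> f constant_on ball 0 1\<close> show False by simp
  qed
qed

text \<open>For strictly bounded \<open>f\<close>, conjugate by disc automorphisms: \<open>S\<close>
  moves 0 to \<open>z\<close>, \<open>T\<close> moves \<open>f z\<close> to 0, and the Schwarz lemma
  bounds the derivative of \<open>T o f o S\<close> at 0. A constant \<open>f\<close> has derivative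
  0.\<close>

lemma Schwarz_Pick_deriv:
  assumes holf: "f holomorphic_on ball 0 1" and le: "\<And>z. cmod z < 1 \<Longrightarrow> cmod (f z) \<le> 1"
    and z: "cmod z < 1"
  shows "cmod (deriv f z) * (1 - (cmod z)\<^sup>2) \<le> 1 - (cmod (f z))\<^sup>2"
  using holomorphic_norm_le_1_cases[OF holf le]
proof
  assume "f constant_on ball 0 1"
  then obtain c where c: "\<And>w. w \<in> ball 0 1 \<Longrightarrow> f w = c"
    unfolding constant_on_def by auto
  have "eventually (\<lambda>w. f w = c) (nhds z)"
    using c z eventually_nhds_in_open[of "ball 0 1" z] by (auto elim: eventually_mono)
  then have "deriv f z = deriv (\<lambda>_. c) z"
    by (rule deriv_cong_ev) simp
  moreover have "(cmod (f z))\<^sup>2 \<le> 1"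
    using le[OF z] by (simp add: power_le_one)
  ultimately show ?thesis by simp
next
  assume lt: "\<forall>z. cmod z < 1 \<longrightarrow> cmod (f z) < 1"
  define w where "w = f z"
  have w: "cmod w < 1" using lt z by (simp add: w_def)
  \<comment> \<open>\<open>Moebius_function 0 a\<close> sends \<open>a\<close> to 0, so the
    parameter \<open>-z\<close> gives the inverse automorphism, which sends 0 to
    \<open>z\<close>.\<close>
  define S where "S = Moebius_function 0 (-z)"
  define T where "T = Moebius_function 0 w"
  define F where "F = T \<circ> (f \<circ> S)"
  have Sball: "S ` ball 0 1 \<subseteq> ball 0 1"
    using Moebius_function_norm_lt_1[of "-z"] z by (auto simp: S_def)
  have holS: "S holomorphic_on ball 0 1" unfolding S_def
    using z by (intro Moebius_function_holomorphic) auto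
  have holT: "T holomorphic_on ball 0 1" unfolding T_def
    using w by (intro Moebius_function_holomorphic) auto
  have holfS: "(f \<circ> S) holomorphic_on ball 0 1"
    using Sball holS holf by (rule holomorphic_on_compose_gen[rotated 2])
  have fball: "(f \<circ> S) ` ball 0 1 \<subseteq> ball 0 1"
    using Sball lt by auto
  have holF: "F holomorphic_on ball 0 1"
    unfolding F_def using fball holfS holT by (rule holomorphic_on_compose_gen[rotated 2])
  have S0: "S 0 = z" by (simp add: S_def Moebius_function_simple)
  have F0: "F 0 = 0" by (simp add: F_def S0 T_def w_def Moebius_function_eq_zero)
  have Flt: "cmod (F \<zeta>) < 1" if "cmod \<zeta> < 1" for \<zeta>
  proof -
    have "\<zeta> \<in> ball 0 1" using that by simp
    then have "cmod (f (S \<zeta>)) < 1" using fball by fastforce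
    then show ?thesis using w by (simp add: F_def T_def Moebius_function_norm_lt_1)
  qed
  have "cmod (deriv F 0) \<le> 1"
    using Schwarz_Lemma(2)[OF holF F0, of 0] Flt by simp
  have dS: "(S has_field_derivative of_real (1 - (cmod z)\<^sup>2)) (at 0)"
    unfolding S_def Moebius_function_simple
    by (auto intro!: derivative_eq_intros simp: complex_norm_square[symmetric] mult.commute)
  have nz: "1 - cnj w * w = of_real (1 - (cmod w)\<^sup>2)"
    by (simp add: complex_norm_square mult.commute del: of_real_power)
  have pos: "1 - (cmod w)\<^sup>2 > 0"
    using w by (simp add: power_less_one_iff abs_square_less_1)
  then have nz0: "1 - cnj w * w \<noteq> 0"
    unfolding nz by (metis less_irrefl of_real_eq_0_iff)
  have dT: "(T has_field_derivative inverse (of_real (1 - (cmod w)\<^sup>2))) (at w)"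
    unfolding T_def Moebius_function_simple nz[symmetric]
  proof (rule DERIV_cong)
    \<comment> \<open>The unsimplified quotient rule: the term with \<open>w - w\<close> vanishes
      and one factor \<open>1 - cnj w * w\<close> cancels.\<close>
    show "((\<lambda>v. (v - w) / (1 - cnj w * v)) has_field_derivative
        (1 * (1 - cnj w * w) - (w - w) * - cnj w) / ((1 - cnj w * w) * (1 - cnj w * w))) (at w)"
      using nz0 by (intro DERIV_divide) (auto intro!: derivative_eq_intros)
  qed (use nz0 in \<open>simp add: divide_inverse\<close>)
  have df: "(f has_field_derivative deriv f z) (at z)"
    using holf z by (intro holomorphic_derivI[of _ "ball 0 1"]) auto
  have "((f \<circ> S) has_field_derivative deriv f z * of_real (1 - (cmod z)\<^sup>2)) (at 0)"
    using df dS by (intro DERIV_chain) (simp_all add: S0)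
  then have "(F has_field_derivative
      inverse (of_real (1 - (cmod w)\<^sup>2)) * (deriv f z * of_real (1 - (cmod z)\<^sup>2))) (at 0)"
    unfolding F_def using dT by (intro DERIV_chain[of T]) (simp_all add: S0 w_def)
  then have "deriv F 0 = inverse (of_real (1 - (cmod w)\<^sup>2)) * (deriv f z * of_real (1 - (cmod z)\<^sup>2))"
    by (rule DERIV_imp_deriv)
  moreover have "1 - (cmod z)\<^sup>2 > 0"
    using z by (simp add: power_less_one_iff abs_square_less_1)
  ultimately have "cmod (deriv F 0) = cmod (deriv f z) * (1 - (cmod z)\<^sup>2) / (1 - (cmod w)\<^sup>2)"
    using pos by (simp add: norm_mult norm_inverse divide_inverse del: of_real_diff of_real_power)
  with \<open>cmod (deriv F 0) \<le> 1\<close> pos show ?thesis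
    by (simp add: w_def field_simps)
qed

section \<open>Factorisation \<open>f z = z * g z\<close> for functions in
  \<open>class_Omega\<close>\<close>

lemma deriv_times_id:
  assumes "g holomorphic_on ball 0 1" "\<And>z. cmod z < 1 \<Longrightarrow> f z = z * g z" "cmod z < 1"
  shows "deriv f z = g z + z * deriv g z"
    and "deriv (deriv f) z = 2 * deriv g z + z * deriv (deriv g) z"
proof -
  have 1: "deriv f z = g z + z * deriv g z" if z: "cmod z < 1" for z
  proof -
    have "(g has_field_derivative deriv g z) (at z)"
      using assms(1) z by (intro holomorphic_derivI[of _ "ball 0 1"]) auto
    then have "((\<lambda>z. z * g z) has_field_derivative g z + z * deriv g z) (at z)"
      by (auto intro!: derivative_eq_intros)
    then have "(f has_field_derivative g z + z * deriv g z) (at z)"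
      by (rule has_field_derivative_transform_within_open[of _ _ _ "ball 0 1"])
         (use z assms(2) in auto)
    then show ?thesis by (rule DERIV_imp_deriv)
  qed
  show "deriv f z = g z + z * deriv g z" by (rule 1) fact
  have "(g has_field_derivative deriv g z) (at z)"
    using assms by (intro holomorphic_derivI[of _ "ball 0 1"]) auto
  moreover have "(deriv g has_field_derivative deriv (deriv g) z) (at z)"
    using assms by (intro holomorphic_derivI[of _ "ball 0 1"] holomorphic_deriv) auto
  ultimately have "((\<lambda>z. g z + z * deriv g z) has_field_derivative
      2 * deriv g z + z * deriv (deriv g) z) (at z)"
    by (auto intro!: derivative_eq_intros)
  then have "(deriv f has_field_derivative 2 * deriv g z + z * deriv (deriv g) z) (at z)"
    by (rule has_field_derivative_transform_within_open[of _ _ _ "ball 0 1"])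
       (use assms(3) 1 in auto)
  then show "deriv (deriv f) z = 2 * deriv g z + z * deriv (deriv g) z"
    by (rule DERIV_imp_deriv)
qed

text \<open>The function \<open>h = 2 (z f' - f) = 2 z^2 g'\<close> has a double zero at 0. The
  Schwarz lemma removes one factor \<open>z\<close> to reach \<open>k\<close>, and a second one to
  reach \<open>2 g'\<close>.\<close>

lemma class_Omega_factor:
  assumes "f \<in> class_Omega"
  obtains g where "g holomorphic_on ball 0 1" "g 0 = 1"
    "\<And>z. cmod z < 1 \<Longrightarrow> f z = z * g z"
    "\<And>z. cmod z < 1 \<Longrightarrow> cmod (2 * deriv g z) \<le> 1"
proof -
  have holf: "f holomorphic_on ball 0 1" and f0: "f 0 = 0" and df0: "deriv f 0 = 1"
    and Om: "\<And>z. cmod z < 1 \<Longrightarrow> cmod (z * deriv f z - f z) < 1 / 2"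
    using assms by (auto simp: class_Omega_def class_A_def)
  obtain g where holg: "g holomorphic_on ball 0 1" and fg: "\<And>z. cmod z < 1 \<Longrightarrow> f z = z * g z"
    and g0: "g 0 = 1"
    using Schwarz3[OF holf f0] df0 by metis
  have holdg: "deriv g holomorphic_on ball 0 1"
    by (intro holomorphic_deriv holg) auto
  have dfg: "deriv f z = g z + z * deriv g z" if "cmod z < 1" for z
    using deriv_times_id(1)[OF holg fg that] by simp
  define k where "k z = z * (2 * deriv g z)" for z
  define h where "h z = z * k z" for z
  have holk: "k holomorphic_on ball 0 1" and holh: "h holomorphic_on ball 0 1"
    unfolding h_def k_def by (intro holomorphic_intros holdg)+
  have heq: "h z = 2 * (z * deriv f z - f z)" if "cmod z < 1" for z
    using that by (simp add: h_def k_def dfg fg algebra_simps)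
  have hlt: "cmod (h z) < 1" if "cmod z < 1" for z
    unfolding heq[OF that] norm_mult using Om[OF that] by simp
  have kle: "cmod (k z) \<le> 1" if "cmod z < 1" for z
  proof (cases "z = 0")
    case False
    have "cmod (h z) \<le> cmod z"
      using Schwarz_Lemma(1)[OF holh _ hlt that] by (simp add: h_def)
    with False show ?thesis by (simp add: h_def norm_mult)
  qed (simp add: k_def)
  have k0: "k 0 = 0" by (simp add: k_def)
  \<comment> \<open>A constant \<open>k\<close> equals \<open>k 0 = 0\<close>, so the bound is
    strict in both cases and the Schwarz lemma applies to \<open>k\<close>.\<close>
  have klt: "cmod (k z) < 1" if "cmod z < 1" for z
    using holomorphic_norm_le_1_cases[OF holk kle]
  proof
    assume "k constant_on ball 0 1"
    then have "k z = k 0" using that by (auto simp: constant_on_def)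
    then show ?thesis by (simp add: k0)
  qed (use that in auto)
  have "cmod (2 * deriv g z) \<le> 1" if "cmod z < 1" for z
  proof (cases "z = 0")
    case False
    have "cmod (k z) \<le> cmod z"
      using Schwarz_Lemma(1)[OF holk k0 klt that] .
    with False show ?thesis by (simp add: k_def norm_mult)
  next
    case True
    \<comment> \<open>At the origin division by \<open>z\<close> is impossible; the derivative form
      of the Schwarz lemma takes over, since \<open>k' 0 = 2 g' 0\<close>.\<close>
    have "(deriv g has_field_derivative deriv (deriv g) 0) (at 0)"
      using holdg by (intro holomorphic_derivI[of _ "ball 0 1"]) auto
    then have "(k has_field_derivative 2 * deriv g 0) (at 0)"
      unfolding k_def by (auto intro!: derivative_eq_intros)
    then have "deriv k 0 = 2 * deriv g 0" by (rule DERIV_imp_deriv)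
    with True show ?thesis
      using Schwarz_Lemma(2)[OF holk k0 klt, of 0] by simp
  qed
  with holg g0 fg show thesis using that by blast
qed

section \<open>Numerical estimate and membership in the class\<close>

text \<open>Here \<open>p\<close> stands for \<open>cmod (2 * deriv g z)\<close>; the left side
  bounds the numerator and the right side bounds \<open>|f'|^2\<close> from below. The upper bounds
  grow with \<open>r\<close> while the lower bound shrinks, so it suffices to treat
  \<open>r = 431/1000\<close>, a convenient rational just above the root.\<close>

lemma radius_estimate:
  fixes r p :: real
  assumes r: "0 \<le> r" "r \<le> 431/1000" and p: "0 \<le> p" "p \<le> 1"
  shows "(r * (p/2) + r\<^sup>2 * ((1 - p\<^sup>2) / (2 * (1 - r\<^sup>2)))) * (1 + r/2) + r\<^sup>2 * (p/2)\<^sup>2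
         < (1 - r/2 - r * (p/2))\<^sup>2"
proof -
  have r2: "r\<^sup>2 \<le> (431/1000)\<^sup>2" using r by (intro power_mono) auto
  have p2: "0 \<le> p\<^sup>2" "p\<^sup>2 \<le> 1" using p by (auto simp: power_le_one)
  define q where "q = (1 - p\<^sup>2) / (2 * (1 - r\<^sup>2))"
  have q: "0 \<le> q" "q \<le> (1 - p\<^sup>2) / (2 * (1 - (431/1000)\<^sup>2))"
    unfolding q_def using r2 p2
    by (intro divide_nonneg_nonneg divide_left_mono; simp add: power2_eq_square)+
  have rp: "r * (p/2) \<le> 431/1000 * (p/2)"
    using r p by (intro mult_right_mono) auto
  have rq: "r\<^sup>2 * q \<le> (431/1000)\<^sup>2 * ((1 - p\<^sup>2) / (2 * (1 - (431/1000)\<^sup>2)))"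
    using r2 q by (intro mult_mono) auto
  have "(r * (p/2) + r\<^sup>2 * q) * (1 + r/2)
      \<le> (431/1000 * (p/2) + (431/1000)\<^sup>2 * ((1 - p\<^sup>2) / (2 * (1 - (431/1000)\<^sup>2)))) * (1 + 431/1000/2)"
    using r p q order_trans[OF _ rq, of 0] by (intro mult_mono add_mono rp rq add_nonneg_nonneg) auto
  moreover have "r\<^sup>2 * (p/2)\<^sup>2 \<le> (431/1000)\<^sup>2 * (p/2)\<^sup>2"
    using r2 by (intro mult_right_mono) auto
  ultimately have "(r * (p/2) + r\<^sup>2 * q) * (1 + r/2) + r\<^sup>2 * (p/2)\<^sup>2
      \<le> (431/1000 * (p/2) + (431/1000)\<^sup>2 * ((1 - p\<^sup>2) / (2 * (1 - (431/1000)\<^sup>2))))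
           * (1 + 431/1000/2) + (431/1000)\<^sup>2 * (p/2)\<^sup>2"
    by (rule add_mono)
  also have "\<dots> < (1 - 431/1000/2 - 431/1000 * (p/2))\<^sup>2"
  proof -
    \<comment> \<open>Right minus left is a quadratic in \<open>p\<close> with positive leading
      coefficient. Subtracting that multiple of \<open>(1 - p)^2\<close> leaves a linear function
      that is positive on [0,1].\<close>
    have "0 \<le> (1 - p) * (1 - p)" using p by simp
    then show ?thesis using p by (simp add: power2_eq_square field_simps)
  qed
  also have "\<dots> \<le> (1 - r/2 - r * (p/2))\<^sup>2"
    using r p rp by (intro power_mono; linarith)
  finally show ?thesis unfolding q_def .
qed

text \<open>Used with \<open>d = f' z\<close>, \<open>e = f'' z\<close>, \<open>G = g z\<close>,
  where \<open>d / G\<close> is the starlike quotient. The class inequality then says that the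
  numerator is smaller in modulus than \<open>d^2\<close>.\<close>

lemma difference_as_quotient:
  fixes d e G z :: complex
  assumes "d \<noteq> 0" "G \<noteq> 0"
  shows "(1 - of_real (1/2) + of_real (1/2) * (z * e / d)) / (d / G) - (1 - of_real (1/2))
       = ((d + z * e) * G - d\<^sup>2) / (2 * d\<^sup>2)"
  using assms by (simp add: field_simps power2_eq_square)

lemma class_Omega_subset_class_G_in:
  assumes f: "f \<in> class_Omega" and R: "R \<le> 431/1000"
  shows "f \<in> class_G_in R (1/2) (1/2)"
proof -
  obtain g where holg: "g holomorphic_on ball 0 1" and g0: "g 0 = 1"
    and fg: "\<And>z. cmod z < 1 \<Longrightarrow> f z = z * g z"
    and dg: "\<And>z. cmod z < 1 \<Longrightarrow> cmod (2 * deriv g z) \<le> 1"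
    by (rule class_Omega_factor[OF f], rule that)
  have holdg: "(\<lambda>z. 2 * deriv g z) holomorphic_on ball 0 1"
    using holomorphic_deriv[OF holg] by (intro holomorphic_on_mult) auto
  have df: "deriv f z = g z + z * deriv g z"
    "deriv (deriv f) z = 2 * deriv g z + z * deriv (deriv g) z" if "cmod z < 1" for z
    using deriv_times_id[OF holg fg that] by simp_all
  have g1: "cmod (g z - 1) \<le> cmod z / 2" if z: "cmod z < 1" for z
  proof -
    \<comment> \<open>Mean value inequality on the convex disc, with
      \<open>|g'| <= 1/2\<close>.\<close>
    have "cmod (g z - g 0) \<le> 1/2 * cmod (z - 0)"
    proof (rule field_differentiable_bound[of "ball 0 1" g "deriv g"])
      fix w :: complex assume w: "w \<in> ball 0 1"
      show "(g has_field_derivative deriv g w) (at w within ball 0 1)"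
        by (rule has_field_derivative_at_within, rule holomorphic_derivI[OF holg]) (use w in auto)
      show "cmod (deriv g w) \<le> 1/2" using dg[of w] w by (simp add: norm_mult)
    qed (use z in auto)
    then show ?thesis by (simp add: g0)
  qed
  have "deriv f z \<noteq> 0 \<and> (z \<noteq> 0 \<longrightarrow> f z \<noteq> 0) \<and>
      cmod ((1 - of_real (1/2) + of_real (1/2) * (z * (deriv ^^ 2) f z / deriv f z))
          / starlike_quotient f z - (1 - of_real (1/2))) < 1/2" if z: "z \<in> ball 0 R" for z
  proof -
    define r where "r = cmod z"
    \<comment> \<open>Keeping \<open>p\<close> as a parameter matters: a large \<open>p\<close>
      enlarges the first-order terms but tightens the Schwarz--Pick bound on
      \<open>g''\<close>.\<close>
    define p where "p = cmod (2 * deriv g z)"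
    have r: "0 \<le> r" "r \<le> 431/1000" and z1: "cmod z < 1"
      using z R by (auto simp: r_def)
    have p: "0 \<le> p" "p \<le> 1" using dg[OF z1] by (auto simp: p_def)
    have gdn: "cmod (deriv g z) = p / 2" by (simp add: p_def norm_mult)
    have gle: "cmod (g z) \<le> 1 + r/2" and gge: "cmod (g z) \<ge> 1 - r/2"
      using g1[OF z1] norm_triangle_ineq[of "g z - 1" 1] norm_triangle_ineq2[of 1 "1 - g z"]
      by (auto simp: r_def norm_minus_commute)
    have gnz: "g z \<noteq> 0" using gge r by auto
    have rp: "r * (p/2) \<le> r * (1/2)" using r p by (intro mult_left_mono) auto
    have fge: "cmod (deriv f z) \<ge> 1 - r/2 - r * (p/2)"
      using gge norm_diff_ineq[of "g z" "z * deriv g z"]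
      by (simp add: df(1)[OF z1] norm_mult gdn r_def)
    have fpos: "1 - r/2 - r * (p/2) > 0" using r rp by simp
    have fnz: "deriv f z \<noteq> 0" using fge fpos by auto
    have "(cmod z)\<^sup>2 < 1" using z1 by (simp add: power_less_one_iff abs_square_less_1)
    moreover have "deriv (\<lambda>z. 2 * deriv g z) z = 2 * deriv (deriv g) z"
      by (rule deriv_cmult, rule holomorphic_on_imp_differentiable_at[of _ "ball 0 1"])
         (use holg z1 in \<open>auto intro: holomorphic_deriv\<close>)
    ultimately have ddg: "cmod (deriv (deriv g) z) \<le> (1 - p\<^sup>2) / (2 * (1 - r\<^sup>2))"
      using Schwarz_Pick_deriv[OF holdg dg z1] by (simp add: p_def r_def norm_mult field_simps)
    define N where "N = z * deriv g z * g z + z\<^sup>2 * deriv (deriv g) z * g z - z\<^sup>2 * (deriv g z)\<^sup>2"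
    \<comment> \<open>The two terms containing \<open>g z\<close> are grouped, so that its bound
      \<open>1 + r/2\<close> is used once as a common factor.\<close>
    have "cmod N \<le> cmod (z * deriv g z + z\<^sup>2 * deriv (deriv g) z) * cmod (g z)
        + cmod (z\<^sup>2 * (deriv g z)\<^sup>2)"
      unfolding N_def norm_mult[symmetric] distrib_right by (rule norm_triangle_ineq4)
    also have "\<dots> \<le> (r * (p/2) + r\<^sup>2 * ((1 - p\<^sup>2) / (2 * (1 - r\<^sup>2)))) * (1 + r/2) + r\<^sup>2 * (p/2)\<^sup>2"
    proof (intro add_mono mult_mono gle)
      have "cmod (z * deriv g z + z\<^sup>2 * deriv (deriv g) z)
          \<le> r * (p/2) + r\<^sup>2 * cmod (deriv (deriv g) z)"
        using norm_triangle_ineq[of "z * deriv g z" "z\<^sup>2 * deriv (deriv g) z"]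
        by (simp add: norm_mult norm_power gdn r_def)
      also have "\<dots> \<le> r * (p/2) + r\<^sup>2 * ((1 - p\<^sup>2) / (2 * (1 - r\<^sup>2)))"
        using ddg by (intro add_left_mono mult_left_mono) auto
      finally show *: "cmod (z * deriv g z + z\<^sup>2 * deriv (deriv g) z) \<le> \<dots>" .
      show "0 \<le> r * (p/2) + r\<^sup>2 * ((1 - p\<^sup>2) / (2 * (1 - r\<^sup>2)))"
        using * norm_ge_zero order_trans by blast
    qed (simp_all add: norm_mult norm_power gdn r_def)
    also have "\<dots> < (1 - r/2 - r * (p/2))\<^sup>2" by (rule radius_estimate[OF r p])
    also have "\<dots> \<le> (cmod (deriv f z))\<^sup>2"
      using fge fpos by (intro power_mono) auto
    finally have Nlt: "cmod N < cmod ((deriv f z)\<^sup>2)" by (simp add: norm_power)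
    show ?thesis
    proof (cases "z = 0")
      case False
      have "starlike_quotient f z = deriv f z / g z"
        using False by (simp add: starlike_quotient_def fg[OF z1])
      moreover have "(deriv ^^ 2) f z = 2 * deriv g z + z * deriv (deriv g) z"
        by (simp add: numeral_2_eq_2 df(2)[OF z1])
      moreover have "(deriv f z + z * (2 * deriv g z + z * deriv (deriv g) z)) * g z
          - (deriv f z)\<^sup>2 = N"
        unfolding df(1)[OF z1] N_def by (simp add: algebra_simps power2_eq_square)
      ultimately have "(1 - of_real (1/2) + of_real (1/2) * (z * (deriv ^^ 2) f z / deriv f z))
          / starlike_quotient f z - (1 - of_real (1/2)) = N / (2 * (deriv f z)\<^sup>2)"
        using difference_as_quotient[OF fnz gnz, of z "(deriv ^^ 2) f z"] by simp
      moreover have "cmod (N / (2 * (deriv f z)\<^sup>2)) < 1/2"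
        using Nlt fnz by (simp add: norm_divide norm_mult norm_power field_simps)
      ultimately show ?thesis
        using fnz gnz False fg[OF z1] by simp
    next
      case True
      \<comment> \<open>At the origin the quotient is defined by a limit, which must be shown to be
        1; the expression inside the modulus is then \<open>1/2 - 1/2 = 0\<close>.\<close>
      have "isCont h 0" if "h holomorphic_on ball 0 1" for h :: "complex \<Rightarrow> complex"
        using holomorphic_on_imp_continuous_on[OF that] by (rule continuous_on_interior) simp
      then have "isCont g 0" "isCont (deriv g) 0"
        using holg holomorphic_deriv[OF holg] by auto
      then have "((\<lambda>w. (g w + w * deriv g w) / g w) \<longlongrightarrow> (g 0 + 0 * deriv g 0) / g 0) (at 0)"
        using g0 by (intro tendsto_intros) (auto simp: isCont_def)
      \<comment> \<open>Near but away from 0, the factor \<open>w\<close> in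
        \<open>f w = w * g w\<close> cancels.\<close>
      moreover have "eventually (\<lambda>w. (g w + w * deriv g w) / g w = w * deriv f w / f w) (at 0)"
        using eventually_at_ball'[OF zero_less_one, of 0 UNIV]
        by (rule eventually_mono) (auto simp: fg df(1))
      ultimately have "((\<lambda>w. w * deriv f w / f w) \<longlongrightarrow> 1) (at 0)"
        by (auto simp: g0 elim: Lim_transform_eventually)
      then have "starlike_quotient f 0 = 1"
        by (simp add: starlike_quotient_def tendsto_Lim)
      then show ?thesis using True fnz by simp
    qed
  qed
  then show ?thesis using f by (auto simp: class_G_in_def class_Omega_def)
qed

section \<open>Locating the smallest positive root\<close>

text \<open>The zeros in \<open>{a..b}\<close> form a compact set, nonempty by the intermediate
  value theorem, so there is a least one. Positivity on (0,a] excludes smaller positive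
  roots.\<close>

lemma smallest_positive_root_exists:
  fixes P :: "real \<Rightarrow> real"
  assumes cont: "continuous_on {a..b} P" and a: "0 < a" "a < b"
    and pos: "\<And>s. 0 < s \<Longrightarrow> s \<le> a \<Longrightarrow> P s > 0" and neg: "P b < 0"
  obtains r where "smallest_positive_root P r" "a < r" "r < b"
proof -
  define Z where "Z = {s \<in> {a..b}. P s = 0}"
  have "\<exists>s\<ge>a. s \<le> b \<and> P s = 0"
    using IVT2'[of P b 0 a] cont a neg pos[of a] by auto
  then have "Z \<noteq> {}" by (auto simp: Z_def)
  moreover have "closed Z"
    unfolding Z_def using cont continuous_closed_preimage_constant by blast
  then have "compact Z"
    unfolding compact_eq_bounded_closed Z_def
    by (auto intro: bounded_subset[OF bounded_closed_interval[of a b]])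
  ultimately have "\<exists>r\<in>Z. \<forall>s\<in>Z. r \<le> s"
    by (intro compact_attains_inf)
  then obtain r where r: "r \<in> Z" and min: "\<And>s. s \<in> Z \<Longrightarrow> r \<le> s"
    by auto
  have "a < r" "r < b" "P r = 0"
    using r pos[of a] neg a by (auto simp: Z_def less_le)
  moreover have "r \<le> s" if "0 < s" "P s = 0" for s
  proof (cases "s \<le> b")
    case True
    then show ?thesis using that pos[of s] min[of s] by (fastforce simp: Z_def)
  qed (use \<open>r < b\<close> in simp)
  ultimately show thesis
    using that a by (auto simp: smallest_positive_root_def)
qed

text \<open>An abbreviation rather than a constant, so that facts about it match the polynomial
  written out in the theorem.\<close>

abbreviation (input) radius_poly :: "real \<Rightarrow> real" where
  "radius_poly \<equiv> \<lambda>r. 55 * r ^ 12 - 28 * r ^ 11 - 854 * r ^ 10 + 148 * r ^ 9 + 2969 * r ^ 8 - 212 * r ^ 7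
           - 4286 * r ^ 6 + 28 * r ^ 5 + 2875 * r ^ 4 + 96 * r ^ 3 - 888 * r ^ 2 - 32 * r + 96"

text \<open>Serves the exact sign checks at rational points.\<close>

lemma radius_poly_Horner:
  "radius_poly r = 96 + r * (-32 + r * (-888 + r * (96 + r * (2875 + r * (28 + r * (-4286
     + r * (-212 + r * (2969 + r * (148 + r * (-854 + r * (-28 + r * 55)))))))))))"
  by (simp add: algebra_simps eval_nat_numeral)

text \<open>The expression is the derivative of \<open>radius_poly\<close>. Its terms of degree 7,
  5, 3, 1 are \<open>r\<close> times a cubic in \<open>r^2\<close> that is at most -373; the other
  positive terms total less than \<open>178 * r\<close>, and -32 makes the inequality
  strict.\<close>

lemma radius_poly_deriv_neg:
  fixes r :: real
  assumes r: "0 \<le> r" "r \<le> 431/1000"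
  shows "660 * r ^ 11 - 308 * r ^ 10 - 8540 * r ^ 9 + 1332 * r ^ 8 + 23752 * r ^ 7 - 1484 * r ^ 6
         - 25716 * r ^ 5 + 140 * r ^ 4 + 11500 * r ^ 3 + 288 * r ^ 2 - 1776 * r - 32 < 0"
proof -
  define s where "s = r\<^sup>2"
  have "r\<^sup>2 \<le> (431/1000)\<^sup>2" using r by (intro power_mono) auto
  then have s: "0 \<le> s" "s \<le> 186/1000" by (auto simp: s_def power2_eq_square)
  have mono: "23752 * s^3 - 25716 * s^2 + 11500 * s - 1776 \<le> -373"
  proof -
    define c :: real where "c = 186/1000"
    \<comment> \<open>The product is the cubic at \<open>c\<close> minus the cubic at
      \<open>s\<close>. The second factor is nonnegative because
      \<open>c + s <= 0.372\<close>.\<close>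
    have "0 \<le> (c - s) * (11500 - 25716 * (c + s) + 23752 * (c\<^sup>2 + c * s + s\<^sup>2))"
      using s by (intro mult_nonneg_nonneg add_nonneg_nonneg)
        (auto simp: c_def power2_eq_square intro!: add_nonneg_nonneg mult_nonneg_nonneg)
    then show ?thesis
      by (simp add: c_def power2_eq_square power3_eq_cube field_simps)
  qed
  have pw: "r * r ^ n \<le> r * (431/1000) ^ n" for n
    using r by (intro mult_left_mono power_mono) auto
  have "r * (23752 * s^3 - 25716 * s^2 + 11500 * s - 1776) \<le> r * (-373)"
    using mono r by (intro mult_left_mono) auto
  then have 1: "23752 * r ^ 7 - 25716 * r ^ 5 + 11500 * r ^ 3 - 1776 * r \<le> - 373 * r"
    by (simp add: s_def algebra_simps eval_nat_numeral)
  have 2: "r ^ 2 \<le> r * (1/2)" "r ^ 4 \<le> r * (1/10)" "r ^ 8 \<le> r * (1/100)" "r ^ 11 \<le> r * (1/100)"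
    using pw[of 1] pw[of 3] pw[of 7] pw[of 10] r
    by (auto simp: eval_nat_numeral field_simps)
  have 3: "0 \<le> r ^ 6" "0 \<le> r ^ 9" "0 \<le> r ^ 10" using r by auto
  show ?thesis using 1 2 3 r by linarith
qed

text \<open>The polynomial decreases up to the right endpoint, so its sign there decides. That
  endpoint is \<open>0.430496 - 0.0000005\<close>, the lower edge of the tolerance in the
  theorem.\<close>

lemma radius_poly_pos:
  fixes s :: real
  assumes s: "0 < s" "s \<le> 4304955/10000000"
  shows "radius_poly s > 0"
proof -
  have "radius_poly (4304955/10000000) \<le> radius_poly s"
  proof (rule DERIV_nonpos_imp_nonincreasing[OF s(2)])
    fix x assume x: "s \<le> x" "x \<le> 4304955/10000000"
    show "\<exists>y. (radius_poly has_real_derivative y) (at x) \<and> y \<le> 0"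
    proof (intro exI conjI)
      show "(radius_poly has_real_derivative
        660 * x ^ 11 - 308 * x ^ 10 - 8540 * x ^ 9 + 1332 * x ^ 8 + 23752 * x ^ 7 - 1484 * x ^ 6
         - 25716 * x ^ 5 + 140 * x ^ 4 + 11500 * x ^ 3 + 288 * x ^ 2 - 1776 * x - 32) (at x)"
        by (auto intro!: derivative_eq_intros)
      show "660 * x ^ 11 - 308 * x ^ 10 - 8540 * x ^ 9 + 1332 * x ^ 8 + 23752 * x ^ 7 - 1484 * x ^ 6
         - 25716 * x ^ 5 + 140 * x ^ 4 + 11500 * x ^ 3 + 288 * x ^ 2 - 1776 * x - 32 \<le> 0"
        using radius_poly_deriv_neg[of x] s x by simp
    qed
  qed
  moreover have "radius_poly (4304955/10000000) > 0"
    unfolding radius_poly_Horner by simp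
  ultimately show ?thesis by linarith
qed

theorem theorem2p12:
  shows "\<exists>r0::real.
    smallest_positive_root
      (\<lambda>r. 55 * r ^ 12 - 28 * r ^ 11 - 854 * r ^ 10 + 148 * r ^ 9 + 2969 * r ^ 8 - 212 * r ^ 7
           - 4286 * r ^ 6 + 28 * r ^ 5 + 2875 * r ^ 4 + 96 * r ^ 3 - 888 * r ^ 2 - 32 * r + 96) r0 \<and>
    \<bar>r0 - 0.430496\<bar> < 0.0000005 \<and>
    (\<forall>f \<in> class_Omega. f \<in> class_G_in r0 (1 / 2) (1 / 2))"
proof -
  \<comment> \<open>The sign change lies between the lower edge of the tolerance and 0.430496
    itself, so the root is slightly below its rounded value.\<close>
  obtain r0 where root: "smallest_positive_root radius_poly r0"
    and r0: "4304955/10000000 < r0" "r0 < 430496/1000000"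
  proof (rule smallest_positive_root_exists[of "4304955/10000000" "430496/1000000" radius_poly])
    show "continuous_on {4304955/10000000..430496/1000000} radius_poly"
      by (intro continuous_intros)
    show "radius_poly (430496/1000000) < 0"
      unfolding radius_poly_Horner by simp
  qed (use radius_poly_pos in auto)
  have "\<bar>r0 - 0.430496\<bar> < 0.0000005" using r0 by (simp add: abs_less_iff)
  moreover have "r0 \<le> 431/1000" using r0 by simp
  ultimately show ?thesis
    using root class_Omega_subset_class_G_in by blast
qed

end
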